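(* (SSC inequality for regularized problems.) Consider the problem $\min_{\mathbf w\in\mathbb R^d}\{F(\mathbf w)=f(\mathbf w)+r(\mathbf w)=h(X\mathbf w)+r(\mathbf w)\}$ under assumptions A1, A2, B1 (stated in the context), with optimal solution set $\mathcal W_r^\star$ and optimal value $F^\star$. Let $B\subseteq\mathbb R^d$ be bounded. Then there exist: $M>0$ with $F(\mathbf w)-F^\star\le M$ for all $\mathbf w\in B$; a convex compact set $\mathcal U\subseteq\mathrm{dom}(h)$ containing $\tilde{\mathbf r}^\star$ and $X\mathbf w$ for all $\mathbf w\in B$; a strong convexity modulus $\mu>0$ of $h$ on $\mathcal U$; and a Hoffman constant $\theta>0$ of the lifted solution set $\widetilde{\mathcal W}^\star$ (defined in the context). For any such $M,\mathcal U,\mu,\theta$, setting $$\beta=\frac{1}{\theta^2\left(\frac{1+2\|\nabla h(\tilde{\mathbf r}^\star)\|^2}{\mu}+M\right)}>0,$$ one has $$F(\mathbf w)-F^\star\ge\frac\beta2\left\|\mathbf w-\Pi_{\mathcal W_r^\star}(\mathbf w)\right\|^2\qquad\text{for all }\mathbf w\in B.$$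
   Context: Norms are Euclidean; $\Pi_S$ is Euclidean projection onto the closed convex set $S$. Here $X\in\mathbb R^{n\times d}$, $h$ is a real-valued function on $\mathrm{dom}(h)\subseteq\mathbb R^n$, $X\mathbf w\in\mathrm{dom}(h)$ for all $\mathbf w\in\mathbb R^d$, $f(\mathbf w)=h(X\mathbf w)$, and $r:\mathbb R^d\to\mathbb R$. A1: $f=\frac1n\sum_{i=1}^n f_i$ with each $f_i:\mathbb R^d\to\mathbb R$ convex and differentiable; $\nabla f$ and $\nabla f_i$ are Lipschitz continuous on $\mathbb R^d$ with constants $L>0$ and $L_i>0$. A2: $\mathrm{dom}(h)$ is open and non-empty; $h$ is continuously differentiable on $\mathrm{dom}(h)$ and strongly convex on any convex compact subset of $\mathrm{dom}(h)$. ($h$ is strongly convex with modulus $\mu>0$ on $\mathcal U$ if $h(\mathbf a)\ge h(\mathbf b)+\nabla h(\mathbf b)^T(\mathbf a-\mathbf b)+\frac\mu2\|\mathbf a-\mathbf b\|^2$ for all $\mathbf a,\mathbf b\in\mathcal U$.) B1: $r$ is convex; its epigraph $\widetilde{\mathcal W}=\{(\mathbf w,\varpi)\in\mathbb R^d\times\mathbb R:r(\mathbf w)\le\varpi\}$ is a polyhedral set, written $\widetilde{\mathcal W}=\{\mathbf z\in\mathbb R^{d+1}:\widetilde C\mathbf z\le\tilde{\mathbf b}\}$; the optimal solution set $\mathcal W_r^\star$ is non-empty. Under these assumptions there are constants $\tilde{\mathbf r}^\star\in\mathbb R^n$, $\tilde s^\star\in\mathbb R$ with $\mathcal W_r^\star=\{\mathbf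 w:X\mathbf w=\tilde{\mathbf r}^\star,\ r(\mathbf w)=\tilde s^\star\}$. The lifted solution set (of minimizing $h(X\mathbf w)+\varpi$ over $\widetilde{\mathcal W}$) is $\widetilde{\mathcal W}^\star=\{(\mathbf w,\varpi)\in\widetilde{\mathcal W}:X\mathbf w=\tilde{\mathbf r}^\star,\ \varpi=\tilde s^\star\}$. Hoffman constant of $\widetilde{\mathcal W}^\star$: a $\theta>0$ such that for every $\mathbf z=(\mathbf w,\varpi)\in\mathbb R^{d+1}$ there is $\mathbf z^\star\in\widetilde{\mathcal W}^\star$ with $\|\mathbf z-\mathbf z^\star\|^2\le\theta^2\left(\|[\widetilde C\mathbf z-\tilde{\mathbf b}]^+\|^2+\|X\mathbf w-\tilde{\mathbf r}^\star\|^2+(\varpi-\tilde s^\star)^2\right)$, where $[\cdot]^+$ is the projection onto the non-negative orthant (such $\theta$ exists by Hoffman's bound). *)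

theory Defs
  imports "HOL-Analysis.Analysis"
begin

text \<open>Meaningful where the function is differentiable; there the gradient is unique.\<close>

definition gradient :: "('a::real_inner \<Rightarrow> real) \<Rightarrow> 'a \<Rightarrow> 'a"
  where "gradient f x = (THE g. GDERIV f x :> g)"

definition continuously_differentiable_on :: "('a::real_inner \<Rightarrow> real) \<Rightarrow> 'a set \<Rightarrow> bool"
  where "continuously_differentiable_on f S \<longleftrightarrow>
    (\<forall>x\<in>S. f differentiable (at x)) \<and> continuous_on S (gradient f)"

definition strongly_convex_on :: "'a::real_inner set \<Rightarrow> real \<Rightarrow> ('a \<Rightarrow> real) \<Rightarrow> bool"
  where "strongly_convex_on S \<mu> f \<longleftrightarrow> \<mu> > 0 \<and>
    (\<forall>a\<in>S. \<forall>b\<in>S. f a \<ge> f b + gradient f b \<bullet> (a - b) + \<mu> / 2 * (norm (a - b))\<^sup>2)"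

text \<open>A matrix with \<open>d + 1\<close> columns is the vector of its rows, and these are elements of
  \<open>(real^'d) \<times> real\<close>, whose inner product and norm are the Euclidean ones.\<close>

definition rows_mult :: "('a::real_inner)^'m \<Rightarrow> 'a \<Rightarrow> real^'m"
  where "rows_mult C z = (\<chi> i. C $ i \<bullet> z)"

definition polyhedral_set :: "('a::real_inner)^'m \<Rightarrow> real^'m \<Rightarrow> 'a set"
  where "polyhedral_set C b = {z. \<forall>i. rows_mult C z $ i \<le> b $ i}"

definition pos_part :: "real^'m \<Rightarrow> real^'m"
  where "pos_part v = closest_point {u. \<forall>i. 0 \<le> u $ i} v"

definition lifted_solution_set ::
    "real^'d^'n \<Rightarrow> (real^'n \<Rightarrow> real) \<Rightarrow> (real^'d \<Rightarrow> real) \<Rightarrow> ((real^'d) \<times> real) set"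
  where "lifted_solution_set X h r =
    {z. is_arg_min (\<lambda>(w, t). h (X *v w) + t) (\<lambda>z. z \<in> epigraph UNIV r) z}"

definition hoffman_constant ::
    "((real^'d) \<times> real) set \<Rightarrow> ((real^'d) \<times> real)^'m \<Rightarrow> real^'m \<Rightarrow> real^'d^'n \<Rightarrow>
     real^'n \<Rightarrow> real \<Rightarrow> real \<Rightarrow> bool"
  where "hoffman_constant Z C b X rs ss \<theta> \<longleftrightarrow> \<theta> > 0 \<and>
    (\<forall>w t. \<exists>z'\<in>Z. (norm ((w, t) - z'))\<^sup>2 \<le>
       \<theta>\<^sup>2 * ((norm (pos_part (rows_mult C (w, t) - b)))\<^sup>2
             + (norm (X *v w - rs))\<^sup>2 + (t - ss)\<^sup>2))"

end

theory Submission
  imports Defs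
begin

text \<open>
  Write \<open>D\<close> for the gap \<open>F w - Fstar\<close>, \<open>g\<close> for the gradient of \<open>h\<close> at \<open>rs\<close>, and put
  \<open>p = g \<bullet> (X *v w - rs) + (r w - ss)\<close>.
  First-order optimality gives \<open>p \<ge> 0\<close>, and strong convexity of \<open>h\<close> gives
  \<open>p + \<mu> / 2 * (norm (X *v w - rs))\<^sup>2 \<le> D\<close>. Thus the gap dominates the squared residual of the
  equation \<open>X *v w = rs\<close>, and also \<open>p\<close>. The residual \<open>r w - ss\<close> differs from \<open>p\<close> by
  at most \<open>norm g\<close> times the norm of the first one, and \<open>p\<^sup>2 \<le> M * p\<close> because
  \<open>p \<le> D \<le> M\<close>; boundedness of \<open>B\<close> enters here, since it turns a linear bound on \<open>p\<close> into
  one on its square. So the gap dominates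
  the sum of the squared residuals of the equations that define the solution set
  (\<open>composite_strong_gap\<close>, \<open>residual_bound_arith\<close>). As \<open>r w = ss\<close> is not a linear equation in
  \<open>w\<close>, the point is lifted to \<open>(w, r w)\<close>, where the equation reads \<open>t = ss\<close> and the
  constraint \<open>r w \<le> t\<close> is polyhedral. Hoffman's bound for the lifted solution set then converts
  residuals into distance.

  The existence of a Hoffman constant (\<open>hoffman_bound\<close>) is shown by compactness. If \<open>y\<close> is the
  projection of \<open>x\<close> onto a polyhedron and \<open>J\<close> is the set of constraints active at \<open>y\<close>, then
  \<open>x - y\<close> lies in the polar of the cone of directions \<open>d\<close> with \<open>a i \<bullet> d \<le> 0\<close> for
  \<open>i \<in> J\<close>. A nonzero vector \<open>v\<close> of this polar is not itself such a direction, as \<open>v \<bullet> v > 0\<close>,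
  so it violates one of these inequalities. On the unit sphere the violation is bounded away from
  \<open>0\<close>, and there are only finitely many sets \<open>J\<close>.
\<close>

section \<open>Hoffman's error bound\<close>

text \<open>
  If \<open>v\<close> is nonzero and violates no inequality \<open>a i \<bullet> v \<le> 0\<close>, then \<open>v\<close> is itself a
  direction of the cone, and polarity yields \<open>v \<bullet> v \<le> 0\<close>. Hence the violation is positive on
  the polar away from \<open>0\<close>; its minimum over the unit sphere is the constant, and homogeneity of
  degree two does the rest.
\<close>

lemma polar_violation_bound:
  fixes a :: "'i \<Rightarrow> 'a::euclidean_space"
  assumes "finite J"
  shows "\<exists>m>0. \<forall>v. (\<forall>d. (\<forall>i\<in>J. a i \<bullet> d \<le> 0) \<longrightarrow> v \<bullet> d \<le> 0) \<longrightarrow>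
    m * (norm v)\<^sup>2 \<le> (\<Sum>i\<in>J. (max 0 (a i \<bullet> v))\<^sup>2)"
proof -
  define D where "D = {d. \<forall>i\<in>J. a i \<bullet> d \<le> 0}"
  define N where "N = (\<Inter>d\<in>D. {v. v \<bullet> d \<le> 0})"
  define g where "g v = (\<Sum>i\<in>J. (max 0 (a i \<bullet> v))\<^sup>2)" for v
  have N_iff: "v \<in> N \<longleftrightarrow> (\<forall>d. (\<forall>i\<in>J. a i \<bullet> d \<le> 0) \<longrightarrow> v \<bullet> d \<le> 0)" for v
    by (auto simp: N_def D_def)
  have "closed N"
    unfolding N_def
    by (intro closed_INT ballI closed_Collect_le continuous_intros)
  then have comp: "compact (sphere 0 1 \<inter> N)"
    by (intro compact_Int_closed compact_sphere)
  have g_pos: "g v > 0" if "v \<in> N" "v \<noteq> 0" for v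
  proof -
    have "g v \<ge> 0" by (simp add: g_def sum_nonneg)
    moreover have "g v \<noteq> 0"
    proof
      assume "g v = 0"
      then have "\<forall>i\<in>J. (max 0 (a i \<bullet> v))\<^sup>2 = 0"
        using assms by (simp add: g_def sum_nonneg_eq_0_iff)
      then have "\<forall>i\<in>J. a i \<bullet> v \<le> 0" by (auto simp: max_def split: if_splits)
      then have "v \<bullet> v \<le> 0" using that(1) N_iff by blast
      then show False using that(2) by (simp add: power2_norm_eq_inner[symmetric])
    qed
    ultimately show ?thesis by simp
  qed
  have "\<exists>m>0. \<forall>u\<in>sphere 0 1 \<inter> N. m \<le> g u"
  proof (cases "sphere 0 1 \<inter> N = {}")
    case True
    then show ?thesis by (intro exI[of _ 1]) auto
  next
    case False
    have "continuous_on (sphere 0 1 \<inter> N) g"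
      unfolding g_def by (intro continuous_intros)
    then obtain u where "u \<in> sphere 0 1 \<inter> N" "\<forall>v\<in>sphere 0 1 \<inter> N. g u \<le> g v"
      using continuous_attains_inf[OF comp False] by blast
    moreover from this have "g u > 0" by (intro g_pos) auto
    ultimately show ?thesis by blast
  qed
  then obtain m where m: "m > 0" "\<And>u. u \<in> sphere 0 1 \<inter> N \<Longrightarrow> m \<le> g u" by blast
  have "m * (norm v)\<^sup>2 \<le> g v" if "v \<in> N" for v
  proof (cases "v = 0")
    case True
    then show ?thesis by (simp add: g_def sum_nonneg)
  next
    case False
    define u where "u = v /\<^sub>R norm v"
    have v: "v = norm v *\<^sub>R u" using False by (simp add: u_def)
    have "u \<in> N"
      using that unfolding N_iff u_def by (auto simp: mult_nonneg_nonpos)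
    moreover have "norm u = 1" using False by (simp add: u_def)
    ultimately have "m \<le> g u" by (intro m(2)) simp
    moreover have "g v = (norm v)\<^sup>2 * g u"
    proof -
      have "max 0 (a i \<bullet> v) = norm v * max 0 (a i \<bullet> u)" for i
        by (subst v, subst inner_scaleR_right) (simp add: max_mult_distrib_left)
      then show ?thesis
        by (simp add: g_def sum_distrib_left power_mult_distrib)
    qed
    ultimately show ?thesis by (simp add: mult.commute[of m] mult_left_mono)
  qed
  then show ?thesis using m(1) unfolding g_def N_iff by blast
qed

text \<open>
  A direction that does not increase any active constraint can be followed for a short while
  without leaving \<open>P\<close>, because the inactive constraints have slack. The variational inequality of
  the projection then applies to the point reached.
\<close>

lemma projection_residual_in_polar:
  fixes a :: "'i \<Rightarrow> 'a::euclidean_space"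
  assumes "finite I"
    and P_def: "P = {x. \<forall>i\<in>I. a i \<bullet> x \<le> b i}"
    and "P \<noteq> {}"
    and d: "\<forall>i\<in>{i\<in>I. a i \<bullet> closest_point P x = b i}. a i \<bullet> d \<le> 0"
  shows "(x - closest_point P x) \<bullet> d \<le> 0"
proof -
  define y where "y = closest_point P x"
  have "P = (\<Inter>i\<in>I. {x. a i \<bullet> x \<le> b i})" unfolding P_def by auto
  then have P: "closed P" "convex P"
    by (auto intro!: closed_INT convex_INT closed_halfspace_le convex_halfspace_le)
  then have "y \<in> P" unfolding y_def using assms(3) by (intro closest_point_in_set)
  have "\<forall>\<^sub>F e in at_right 0. a i \<bullet> (y + e *\<^sub>R d) \<le> b i" if "i \<in> I" for i
  proof (cases "a i \<bullet> y = b i")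
    case True
    then have "a i \<bullet> d \<le> 0" using d that by (auto simp: y_def)
    then have "\<forall>e>0. a i \<bullet> (y + e *\<^sub>R d) \<le> b i"
      using True by (auto simp: inner_add_right mult_nonneg_nonpos)
    then show ?thesis by (auto simp: eventually_at_filter)
  next
    case False
    then have "a i \<bullet> y < b i" using \<open>y \<in> P\<close> that by (force simp: P_def)
    moreover have "((\<lambda>e. a i \<bullet> (y + e *\<^sub>R d)) \<longlongrightarrow> a i \<bullet> (y + 0 *\<^sub>R d)) (at_right 0)"
      by (intro tendsto_intros)
    ultimately have "\<forall>\<^sub>F e in at_right 0. a i \<bullet> (y + e *\<^sub>R d) < b i"
      by (intro order_tendstoD(2)) simp_all
    then show ?thesis by eventually_elim simp
  qed
  then have "\<forall>\<^sub>F e in at_right 0. \<forall>i\<in>I. a i \<bullet> (y + e *\<^sub>R d) \<le> b i"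
    using assms(1) by (simp add: eventually_ball_finite)
  then have "\<forall>\<^sub>F e in at_right (0::real). e > 0 \<and> y + e *\<^sub>R d \<in> P"
    using eventually_at_right_less[of "0::real"] by eventually_elim (simp add: P_def)
  then obtain e :: real where "e > 0" "y + e *\<^sub>R d \<in> P"
    using eventually_happens trivial_limit_at_right_real by blast
  then have "(x - y) \<bullet> (y + e *\<^sub>R d - y) \<le> 0"
    unfolding y_def by (intro closest_point_dot P)
  then show ?thesis using \<open>e > 0\<close> by (simp add: y_def mult_le_0_iff)
qed

text \<open>
  The constraints active at the projection \<open>y\<close> satisfy \<open>a i \<bullet> (x - y) = a i \<bullet> x - b i\<close>, so for
  them the violation of the cone inequality by \<open>x - y\<close> is the violation of the constraint by
  \<open>x\<close>. The active set depends on \<open>x\<close>, but only through finitely many values.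
\<close>

theorem hoffman_bound_inequalities:
  fixes a :: "'i \<Rightarrow> 'a::euclidean_space"
  assumes "finite I" and P_def: "P = {x. \<forall>i\<in>I. a i \<bullet> x \<le> b i}" and "P \<noteq> {}"
  shows "\<exists>K>0. \<forall>x. \<exists>y\<in>P. (norm (x - y))\<^sup>2 \<le> K * (\<Sum>i\<in>I. (max 0 (a i \<bullet> x - b i))\<^sup>2)"
proof -
  have "\<forall>J\<in>Pow I. \<exists>m>0. \<forall>v. (\<forall>d. (\<forall>i\<in>J. a i \<bullet> d \<le> 0) \<longrightarrow> v \<bullet> d \<le> 0) \<longrightarrow>
    m * (norm v)\<^sup>2 \<le> (\<Sum>i\<in>J. (max 0 (a i \<bullet> v))\<^sup>2)"
    using assms(1) by (auto intro: polar_violation_bound finite_subset)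
  then obtain m where m: "\<And>J. J \<subseteq> I \<Longrightarrow> m J > 0"
      "\<And>J v. J \<subseteq> I \<Longrightarrow> (\<And>d. \<forall>i\<in>J. a i \<bullet> d \<le> 0 \<Longrightarrow> v \<bullet> d \<le> 0) \<Longrightarrow>
        m J * (norm v)\<^sup>2 \<le> (\<Sum>i\<in>J. (max 0 (a i \<bullet> v))\<^sup>2)"
    unfolding bchoice_iff by (metis PowI)
  define m0 where "m0 = Min (m ` Pow I)"
  have m0: "m0 > 0" 
    unfolding m0_def using m(1) assms(1) by (subst Min_gr_iff) auto
  have m0_le: "m0 \<le> m J" if "J \<subseteq> I" for J
    using that assms(1) by (auto simp: m0_def)
  have P: "closed P"
  proof -
    have "P = (\<Inter>i\<in>I. {x. a i \<bullet> x \<le> b i})" unfolding P_def by auto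
    then show ?thesis by (auto intro!: closed_INT closed_halfspace_le)
  qed
  have "(norm (x - closest_point P x))\<^sup>2 \<le> 1 / m0 * (\<Sum>i\<in>I. (max 0 (a i \<bullet> x - b i))\<^sup>2)" for x
  proof -
    define y where "y = closest_point P x"
    define J where "J = {i\<in>I. a i \<bullet> y = b i}"
    have J: "J \<subseteq> I" by (auto simp: J_def)
    have "m0 * (norm (x - y))\<^sup>2 \<le> m J * (norm (x - y))\<^sup>2"
      by (intro mult_right_mono m0_le J) simp
    also have "\<dots> \<le> (\<Sum>i\<in>J. (max 0 (a i \<bullet> (x - y)))\<^sup>2)"
      using projection_residual_in_polar[OF assms] J
      by (intro m(2)) (auto simp: J_def y_def)
    also have "\<dots> = (\<Sum>i\<in>J. (max 0 (a i \<bullet> x - b i))\<^sup>2)"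
      by (intro sum.cong) (auto simp: J_def inner_diff_right)
    also have "\<dots> \<le> (\<Sum>i\<in>I. (max 0 (a i \<bullet> x - b i))\<^sup>2)"
      by (intro sum_mono2 assms J) auto
    finally show ?thesis using m0 by (simp add: y_def field_simps)
  qed
  moreover have "closest_point P x \<in> P" for x
    using P assms(3) by (rule closest_point_in_set)
  ultimately show ?thesis using m0 by (intro exI[of _ "1 / m0"]) auto
qed

text \<open>
  An equation is a pair of opposite inequalities, and the squares of the two positive parts of its
  residual add up to the square of the residual.
\<close>

corollary hoffman_bound:
  fixes a :: "'i \<Rightarrow> 'a::euclidean_space" and e :: "'j \<Rightarrow> 'a"
  assumes "finite I" "finite J"
    and P_def: "P = {x. (\<forall>i\<in>I. a i \<bullet> x \<le> b i) \<and> (\<forall>j\<in>J. e j \<bullet> x = c j)}"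
    and "P \<noteq> {}"
  shows "\<exists>K>0. \<forall>x. \<exists>y\<in>P. (norm (x - y))\<^sup>2 \<le>
    K * ((\<Sum>i\<in>I. (max 0 (a i \<bullet> x - b i))\<^sup>2) + (\<Sum>j\<in>J. (e j \<bullet> x - c j)\<^sup>2))"
proof -
  define A where "A = case_sum a (case_sum e (\<lambda>j. - e j))"
  define q where "q = case_sum b (case_sum c (\<lambda>j. - c j))"
  define T where "T = I <+> (J <+> J)"
  have P: "P = {x. \<forall>k\<in>T. A k \<bullet> x \<le> q k}"
    unfolding P_def T_def A_def q_def by (auto simp: Plus_def ball_Un intro: antisym)
  have res: "(\<Sum>k\<in>T. (max 0 (A k \<bullet> x - q k))\<^sup>2) =
      (\<Sum>i\<in>I. (max 0 (a i \<bullet> x - b i))\<^sup>2) + (\<Sum>j\<in>J. (e j \<bullet> x - c j)\<^sup>2)" for x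
  proof -
    have "(max 0 t)\<^sup>2 + (max 0 (- t))\<^sup>2 = t\<^sup>2" for t :: real
      by (auto simp: max_def)
    from this[of "e j \<bullet> x - c j" for j]
    have "(max 0 (e j \<bullet> x - c j))\<^sup>2 + (max 0 (c j - e j \<bullet> x))\<^sup>2 = (e j \<bullet> x - c j)\<^sup>2" for j
      by simp
    then show ?thesis
      using assms(1,2) by (simp add: T_def A_def q_def sum.Plus sum.distrib[symmetric])
  qed
  have "finite T" using assms(1,2) by (simp add: T_def)
  from hoffman_bound_inequalities[OF this P assms(4)] show ?thesis
    by (simp add: res)
qed

lemma pos_part_nth: "pos_part v $ i = max 0 (v $ i)"
proof -
  let ?p = "\<chi> i. max 0 (v $ i)"
  have eq: "{u::real^'a. \<forall>i. 0 \<le> u $ i} = (\<Inter>i. {u. 0 \<le> u $ i})" by auto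
  have "closed {u::real^'a. \<forall>i. 0 \<le> u $ i}"
    unfolding eq by (intro closed_INT ballI closed_Collect_le continuous_intros)
  moreover have "convex {u::real^'a. \<forall>i. 0 \<le> u $ i}"
    by (auto simp: convex_def)
  moreover have "dist v ?p \<le> dist v u" if "\<forall>i. 0 \<le> u $ i" for u
    unfolding dist_vec_def
  proof (intro L2_set_mono)
    fix j
    show "dist (v $ j) (?p $ j) \<le> dist (v $ j) (u $ j)"
      using that[rule_format, of j] by (simp add: dist_real_def)
  qed simp
  ultimately have "?p = pos_part v"
    unfolding pos_part_def by (intro closest_point_unique) auto
  then show ?thesis by (metis vec_lambda_beta)
qed

lemma norm_vec_sq: "(norm (v :: real^'k))\<^sup>2 = (\<Sum>i\<in>UNIV. (v $ i)\<^sup>2)"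
  by (simp add: norm_vec_def L2_set_def sum_nonneg)

lemma hoffman_constant_exists:
  fixes X :: "real^'d^'n" and C :: "((real^'d) \<times> real)^'m"
  assumes Z: "Z = {(w, t) \<in> polyhedral_set C b. X *v w = rs \<and> t = ss}" and "Z \<noteq> {}"
  shows "\<exists>\<theta>. hoffman_constant Z C b X rs ss \<theta>"
proof -
  \<comment> \<open>The index \<open>None\<close> stands for the equation \<open>t = ss\<close>, and \<open>Some j\<close> for row \<open>j\<close> of
    \<open>X *v w = rs\<close>.\<close>
  define e where "e = case_option (0, 1 :: real) (\<lambda>j. (row j X, 0))"
  define q where "q = case_option ss (\<lambda>j. rs $ j)"
  have Xw: "row j X \<bullet> w = (X *v w) $ j" for j w
    by (simp add: matrix_vector_mult_def row_def inner_vec_def)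
  have Z': "Z = {z. (\<forall>i\<in>UNIV. C $ i \<bullet> z \<le> b $ i) \<and> (\<forall>j\<in>UNIV. e j \<bullet> z = q j)}"
    unfolding Z polyhedral_set_def rows_mult_def e_def q_def
    by (auto simp: UNIV_option_conv Xw vec_eq_iff split: option.splits)
  obtain K where K: "K > 0" "\<And>z. \<exists>y\<in>Z. (norm (z - y))\<^sup>2 \<le>
      K * ((\<Sum>i\<in>UNIV. (max 0 (C $ i \<bullet> z - b $ i))\<^sup>2) + (\<Sum>j\<in>UNIV. (e j \<bullet> z - q j)\<^sup>2))"
    using hoffman_bound[OF finite finite Z' assms(2)] by blast
  have eq_res: "(\<Sum>j\<in>UNIV. (e j \<bullet> (w, t) - q j)\<^sup>2) = (norm (X *v w - rs))\<^sup>2 + (t - ss)\<^sup>2" for w t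
    by (simp add: UNIV_option_conv sum.reindex e_def q_def norm_vec_sq Xw)
  have ineq_res:
    "(\<Sum>i\<in>UNIV. (max 0 (C $ i \<bullet> z - b $ i))\<^sup>2) = (norm (pos_part (rows_mult C z - b)))\<^sup>2" for z
    by (simp add: norm_vec_sq pos_part_nth rows_mult_def)
  have "(sqrt K)\<^sup>2 = K" using K(1) by simp
  then have "\<exists>y\<in>Z. (norm ((w, t) - y))\<^sup>2 \<le> (sqrt K)\<^sup>2 *
      ((norm (pos_part (rows_mult C (w, t) - b)))\<^sup>2 + (norm (X *v w - rs))\<^sup>2 + (t - ss)\<^sup>2)" for w t
    using K(2)[of "(w, t)", unfolded ineq_res eq_res] by (simp only: add.assoc)
  then have "hoffman_constant Z C b X rs ss (sqrt K)"
    using K(1) by (simp add: hoffman_constant_def)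
  then show ?thesis ..
qed

section \<open>Composite objectives at a minimizer\<close>

lemma gradient_has_gderiv:
  fixes f :: "'a::euclidean_space \<Rightarrow> real"
  assumes "f differentiable (at x)"
  shows "GDERIV f x :> gradient f x"
proof -
  from assms obtain f' where f': "(f has_derivative f') (at x)"
    by (auto simp: differentiable_def)
  then interpret bounded_linear f' by (rule has_derivative_bounded_linear)
  have "f' y = y \<bullet> adjoint f' 1" for y
    using adjoint_works[OF linear_axioms, of y 1] by simp
  then have "f' = (\<lambda>y. y \<bullet> adjoint f' 1)" by auto
  with f' have *: "GDERIV f x :> adjoint f' 1" by (simp add: gderiv_def)
  show ?thesis unfolding gradient_def
  proof (rule theI[where P = "\<lambda>g. GDERIV f x :> g", OF *])
    fix g assume "GDERIV f x :> g"
    with * have "(\<lambda>y. y \<bullet> g) = (\<lambda>y. y \<bullet> adjoint f' 1)"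
      unfolding gderiv_def by (rule has_derivative_unique[rotated])
    then have "y \<bullet> g = y \<bullet> adjoint f' 1" for y by (rule fun_cong)
    then show "g = adjoint f' 1" using vector_eq_ldot by blast
  qed
qed

text \<open>
  Along the segment from \<open>w0\<close> to \<open>w\<close>, convexity replaces the nonsmooth \<open>r\<close> by its chord. The
  resulting upper bound \<open>\<psi>\<close> of the objective is differentiable and agrees with it at \<open>w0\<close>, so
  its slope there cannot be negative.
\<close>

lemma composite_first_order_optimality:
  fixes X :: "real^'d^'n"
  assumes diff: "h differentiable (at (X *v w0))"
    and r: "convex_on UNIV r"
    and min: "\<And>w. h (X *v w0) + r w0 \<le> h (X *v w) + r w"
  shows "0 \<le> gradient h (X *v w0) \<bullet> (X *v w - X *v w0) + (r w - r w0)"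
proof (rule ccontr)
  define u where "u = X *v w - X *v w0"
  define \<psi> where "\<psi> s = h (X *v w0 + s *\<^sub>R u) + s * (r w - r w0)" for s
  assume neg: "\<not> ?thesis"
  have "(h has_derivative (\<lambda>y. y \<bullet> gradient h (X *v w0))) (at (X *v w0 + 0 *\<^sub>R u))"
    using gradient_has_gderiv[OF diff] by (simp add: gderiv_def)
  moreover have "((\<lambda>s. X *v w0 + s *\<^sub>R u) has_derivative (\<lambda>s. s *\<^sub>R u)) (at (0::real))"
    by (auto intro!: derivative_eq_intros)
  ultimately have "((\<lambda>s. h (X *v w0 + s *\<^sub>R u)) has_derivative
      (\<lambda>s. (s *\<^sub>R u) \<bullet> gradient h (X *v w0))) (at 0)"
    using has_derivative_compose[of "\<lambda>s. X *v w0 + s *\<^sub>R u" "\<lambda>s. s *\<^sub>R u" "0::real" UNIV h]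
    by blast
  moreover have "(\<lambda>s. (s *\<^sub>R u) \<bullet> gradient h (X *v w0)) = (*) (u \<bullet> gradient h (X *v w0))"
    by (simp add: fun_eq_iff)
  ultimately have "((\<lambda>s. h (X *v w0 + s *\<^sub>R u)) has_real_derivative (u \<bullet> gradient h (X *v w0))) (at 0)"
    by (simp only: has_field_derivative_def)
  moreover have "((\<lambda>s. s * (r w - r w0)) has_real_derivative (r w - r w0)) (at 0)"
    by (auto intro!: derivative_eq_intros)
  ultimately have "(\<psi> has_real_derivative (u \<bullet> gradient h (X *v w0) + (r w - r w0))) (at 0)"
    unfolding \<psi>_def by (rule DERIV_add)
  moreover have "u \<bullet> gradient h (X *v w0) + (r w - r w0) < 0"
    using neg by (simp add: u_def inner_commute)
  ultimately obtain d where d: "d > 0" "\<And>s. s > 0 \<Longrightarrow> s < d \<Longrightarrow> \<psi> s < \<psi> 0"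
    using DERIV_neg_dec_right[of \<psi> _ 0] by auto
  define s where "s = min (1/2) (d/2)"
  have s: "0 < s" "s < d" "s < 1" using d(1) by (auto simp: s_def)
  define v where "v = (1 - s) *\<^sub>R w0 + s *\<^sub>R w"
  have Xv: "X *v v = X *v w0 + s *\<^sub>R u"
    by (simp add: v_def u_def matrix_vector_right_distrib matrix_vector_mult_diff_distrib
        matrix_vector_mult_scaleR scaleR_diff_left scaleR_diff_right)
  have "r v \<le> (1 - s) * r w0 + s * r w"
    using convex_onD[OF r, of s w0 w] s by (simp add: v_def)
  then have "\<psi> 0 \<le> \<psi> s"
    using min[of v] unfolding \<psi>_def Xv by (simp add: algebra_simps)
  with d(2)[OF s(1,2)] show False by simp
qed

text \<open>
  Here \<open>\<delta>\<close> and \<open>\<rho>\<close> are the residuals of the two equations and \<open>D\<close> is the gap. Splitting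
  \<open>\<rho> = p + (\<rho> - p)\<close> bounds \<open>\<rho>\<^sup>2\<close> by \<open>2 * p\<^sup>2 + 2 * G\<^sup>2 * \<delta>\<^sup>2\<close>. The term \<open>\<delta>\<^sup>2\<close> is linear in
  the gap, whereas \<open>p\<^sup>2\<close> is quadratic and needs the cap \<open>M\<close>.
\<close>

lemma residual_bound_arith:
  fixes \<mu> M D p G \<delta> \<rho> :: real
  assumes "\<mu> > 0" "0 \<le> p" "p + \<mu> / 2 * \<delta>\<^sup>2 \<le> D" "D \<le> M" "\<bar>\<rho> - p\<bar> \<le> G * \<delta>"
  shows "\<delta>\<^sup>2 + \<rho>\<^sup>2 \<le> 2 * ((1 + 2 * G\<^sup>2) / \<mu> + M) * D"
proof -
  have p: "p \<le> D" using assms(1,3) by (smt (verit) zero_le_power2 mult_nonneg_nonneg divide_nonneg_pos)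
  then have D: "0 \<le> D" using assms(2) by simp
  have "(\<rho> - p)\<^sup>2 \<le> (G * \<delta>)\<^sup>2"
    using assms(5) by (metis abs_ge_zero power2_abs power_mono)
  moreover have "\<rho>\<^sup>2 \<le> 2 * (\<rho> - p)\<^sup>2 + 2 * p\<^sup>2"
    using zero_le_power2[of "\<rho> - 2 * p"] by (simp add: power2_eq_square algebra_simps)
  ultimately have "\<delta>\<^sup>2 + \<rho>\<^sup>2 \<le> (1 + 2 * G\<^sup>2) * \<delta>\<^sup>2 + 2 * p\<^sup>2"
    by (simp add: power_mult_distrib algebra_simps)
  also have "\<dots> \<le> (1 + 2 * G\<^sup>2) * (2 / \<mu> * D) + 2 * (M * D)"
  proof (intro add_mono mult_left_mono)
    show "\<delta>\<^sup>2 \<le> 2 / \<mu> * D"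
      using assms(1-3) by (simp add: field_simps)
    show "p\<^sup>2 \<le> M * D"
      unfolding power2_eq_square using p D assms(2,4) by (intro mult_mono) auto
  qed auto
  also have "\<dots> = 2 * ((1 + 2 * G\<^sup>2) / \<mu> + M) * D"
    by (simp add: algebra_simps add_divide_distrib)
  finally show ?thesis .
qed

text \<open>
  The gap splits into the linearized gap \<open>p\<close> and a quadratic remainder. Keeping \<open>p\<close> on the left
  of the second bound is what later controls the residual of \<open>r w = r w0\<close>.
\<close>

lemma composite_strong_gap:
  fixes X :: "real^'d^'n"
  assumes diff: "h differentiable (at (X *v w0))"
    and r: "convex_on UNIV r"
    and min: "\<And>w. h (X *v w0) + r w0 \<le> h (X *v w) + r w"
    and sc: "strongly_convex_on U \<mu> h" and U: "X *v w0 \<in> U" "X *v w \<in> U"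
  defines "p \<equiv> gradient h (X *v w0) \<bullet> (X *v w - X *v w0) + (r w - r w0)"
  shows "0 \<le> p"
    and "p + \<mu> / 2 * (norm (X *v w - X *v w0))\<^sup>2 \<le> (h (X *v w) + r w) - (h (X *v w0) + r w0)"
proof -
  show "0 \<le> p" unfolding p_def by (rule composite_first_order_optimality[OF diff r min])
  have "h (X *v w) \<ge> h (X *v w0) + gradient h (X *v w0) \<bullet> (X *v w - X *v w0)
      + \<mu> / 2 * (norm (X *v w - X *v w0))\<^sup>2"
    using sc U by (simp add: strongly_convex_on_def)
  then show "p + \<mu> / 2 * (norm (X *v w - X *v w0))\<^sup>2 \<le> (h (X *v w) + r w) - (h (X *v w0) + r w0)"
    by (simp add: p_def)
qed

section \<open>The error bound for regularized problems\<close>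

theorem lemma2:
  fixes X :: "real^'d^'n"
    and domh :: "(real^'n) set" and h :: "real^'n \<Rightarrow> real"
    and fi :: "'n \<Rightarrow> real^'d \<Rightarrow> real" and f r F :: "real^'d \<Rightarrow> real"
    and L :: real and Li :: "'n \<Rightarrow> real"
    and C :: "((real^'d) \<times> real)^'m" and b :: "real^'m"
    and W :: "(real^'d) set" and Fstar :: real
    and B :: "(real^'d) set"
  assumes X_dom: "\<And>w. X *v w \<in> domh"
    and f_def: "\<And>w. f w = h (X *v w)"
    and F_def: "\<And>w. F w = f w + r w"
    and W_def: "W = {w. is_arg_min F (\<lambda>_. True) w}"
    and Fstar_def: "Fstar = (INF w. F w)"
    and A1_mean: "\<And>w. f w = (1 / real CARD('n)) * (\<Sum>i\<in>UNIV. fi i w)"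
    and A1_convex: "\<And>i. convex_on UNIV (fi i)"
    and A1_diff: "\<And>i w. fi i differentiable (at w)"
    and A1_L: "L > 0" "L-lipschitz_on UNIV (gradient f)"
    and A1_Li: "\<And>i. Li i > 0" "\<And>i. (Li i)-lipschitz_on UNIV (gradient (fi i))"
    and A2_dom: "open domh" "domh \<noteq> {}"
    and A2_C1: "continuously_differentiable_on h domh"
    and A2_strong: "\<And>K. K \<subseteq> domh \<Longrightarrow> convex K \<Longrightarrow> compact K \<Longrightarrow> \<exists>\<mu>. strongly_convex_on K \<mu> h"
    and B1_convex: "convex_on UNIV r"
    and B1_poly: "epigraph UNIV r = polyhedral_set C b"
    and B1_nonempty: "W \<noteq> {}"
    and B_bounded: "bounded B"
  shows "(\<exists>rs ss. W = {w. X *v w = rs \<and> r w = ss}) \<and>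
    (\<forall>rs ss. W = {w. X *v w = rs \<and> r w = ss} \<longrightarrow>
      lifted_solution_set X h r = {(w, t) \<in> epigraph UNIV r. X *v w = rs \<and> t = ss} \<and>
      (\<exists>M U \<mu> \<theta>.
        M > 0 \<and> (\<forall>w\<in>B. F w - Fstar \<le> M) \<and>
        U \<subseteq> domh \<and> convex U \<and> compact U \<and> rs \<in> U \<and> (\<forall>w\<in>B. X *v w \<in> U) \<and>
        strongly_convex_on U \<mu> h \<and>
        hoffman_constant (lifted_solution_set X h r) C b X rs ss \<theta>) \<and>
      (\<forall>M U \<mu> \<theta>.
        M > 0 \<and> (\<forall>w\<in>B. F w - Fstar \<le> M) \<and>
        U \<subseteq> domh \<and> convex U \<and> compact U \<and> rs \<in> U \<and> (\<forall>w\<in>B. X *v w \<in> U) \<and>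
        strongly_convex_on U \<mu> h \<and>
        hoffman_constant (lifted_solution_set X h r) C b X rs ss \<theta> \<longrightarrow>
        (let \<beta> = 1 / (\<theta>\<^sup>2 * ((1 + 2 * (norm (gradient h rs))\<^sup>2) / \<mu> + M)) in
          \<beta> > 0 \<and>
          (\<forall>w\<in>B. F w - Fstar \<ge> \<beta> / 2 * (norm (w - closest_point W w))\<^sup>2))))"
proof -
  have diff: "h differentiable (at (X *v w))" for w
    using A2_C1 X_dom by (auto simp: continuously_differentiable_on_def)
  have cont_r: "continuous_on UNIV r"
    by (intro convex_on_continuous B1_convex) auto
  have min_iff: "w \<in> W \<longleftrightarrow> (\<forall>v. F w \<le> F v)" for w
    by (auto simp: W_def is_arg_min_linorder)
  obtain w0 where w0: "w0 \<in> W" using B1_nonempty by blast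
  have Fw0: "F w0 \<le> F v" for v using w0 min_iff by blast
  have Fstar: "Fstar = F w0"
    unfolding Fstar_def using Fw0 by (intro cInf_eq_minimum) auto
  have F: "F w = h (X *v w) + r w" for w by (simp add: F_def f_def)
  have min_h: "h (X *v w0) + r w0 \<le> h (X *v w) + r w" for w
    using Fw0[of w] by (simp add: F)
  have img: "(*v) X ` S \<subseteq> domh" "convex ((*v) X ` S)" "compact ((*v) X ` S)"
    if "convex S" "compact S" for S
    using that X_dom
    by (auto intro!: convex_linear_image compact_continuous_image linear_continuous_on
        matrix_vector_mul_bounded_linear)

  \<comment> \<open>The image under \<open>X\<close> of the segment between two minimizers is a compact convex subset of
    \<open>domh\<close>; strong convexity on it forces its end points to coincide.\<close>
  have X_unique: "X *v w = X *v w0" if "w \<in> W" for w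
  proof -
    have seg: "convex (closed_segment w0 w)" "compact (closed_segment w0 w)" by auto
    obtain \<mu> where sc: "strongly_convex_on ((*v) X ` closed_segment w0 w) \<mu> h"
      using A2_strong[OF img[OF seg]] by blast
    have "\<mu> / 2 * (norm (X *v w - X *v w0))\<^sup>2 \<le> 0"
    proof -
      have "X *v w0 \<in> (*v) X ` closed_segment w0 w" "X *v w \<in> (*v) X ` closed_segment w0 w"
        by auto
      note gap = composite_strong_gap[OF diff B1_convex min_h sc this]
      moreover have "F w \<le> F w0" using that min_iff by blast
      ultimately show ?thesis unfolding F by linarith
    qed
    moreover have "\<mu> > 0" using sc by (simp add: strongly_convex_on_def)
    ultimately show ?thesis by (simp add: mult_le_0_iff)
  qed
  have W_eq: "W = {w. X *v w = X *v w0 \<and> r w = r w0}"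
  proof (intro equalityI subsetI)
    fix w assume w: "w \<in> W"
    moreover have "F w = F w0" using w w0 min_iff by (meson antisym)
    ultimately show "w \<in> {w. X *v w = X *v w0 \<and> r w = r w0}"
      using X_unique by (simp add: F)
  next
    fix w assume "w \<in> {w. X *v w = X *v w0 \<and> r w = r w0}"
    then have "F w = F w0" by (simp add: F)
    then show "w \<in> W" using Fw0 min_iff by simp
  qed
  have W_closed: "closed W"
    unfolding W_eq
    by (intro closed_Collect_conj closed_Collect_eq cont_r continuous_on_const
        linear_continuous_on matrix_vector_mul_bounded_linear)

  let ?rs = "X *v w0" and ?ss = "r w0" and ?Z = "lifted_solution_set X h r"
  have Z: "?Z = {(w, t) \<in> epigraph UNIV r. X *v w = ?rs \<and> t = ?ss}"
  proof -
    have "z \<in> ?Z \<longleftrightarrow> z \<in> {(w, t) \<in> epigraph UNIV r. X *v w = ?rs \<and> t = ?ss}" for z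
    proof -
      obtain w t where z: "z = (w, t)" by force
      have "(w, t) \<in> ?Z \<longleftrightarrow> r w \<le> t \<and> (\<forall>v s. r v \<le> s \<longrightarrow> h (X *v w) + t \<le> h (X *v v) + s)"
        by (auto simp: lifted_solution_set_def is_arg_min_linorder mem_epigraph)
      also have "\<dots> \<longleftrightarrow> r w \<le> t \<and> X *v w = ?rs \<and> t = ?ss"
      proof
        assume *: "r w \<le> t \<and> (\<forall>v s. r v \<le> s \<longrightarrow> h (X *v w) + t \<le> h (X *v v) + s)"
        then have 1: "h (X *v w) + t \<le> h ?rs + ?ss" by blast
        with * have "F w \<le> F w0" unfolding F by linarith
        then have "w \<in> W" using Fw0 min_iff by (meson order_trans)
        then have "X *v w = ?rs" "r w = ?ss" using W_eq by auto
        with 1 * show "r w \<le> t \<and> X *v w = ?rs \<and> t = ?ss" by auto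
      next
        assume *: "r w \<le> t \<and> X *v w = ?rs \<and> t = ?ss"
        have "h ?rs + ?ss \<le> h (X *v v) + s" if "r v \<le> s" for v s
          using min_h[of v] that by linarith
        with * show "r w \<le> t \<and> (\<forall>v s. r v \<le> s \<longrightarrow> h (X *v w) + t \<le> h (X *v v) + s)"
          by auto
      qed
      finally show ?thesis by (auto simp: z mem_epigraph)
    qed
    then show ?thesis by (rule set_eqI)
  qed

  have constants_exist: "\<exists>M U \<mu> \<theta>. M > 0 \<and> (\<forall>w\<in>B. F w - Fstar \<le> M) \<and>
      U \<subseteq> domh \<and> convex U \<and> compact U \<and> ?rs \<in> U \<and> (\<forall>w\<in>B. X *v w \<in> U) \<and>
      strongly_convex_on U \<mu> h \<and> hoffman_constant ?Z C b X ?rs ?ss \<theta>"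
  proof -
    have "bounded (insert w0 B)" using B_bounded by simp
    then obtain R where "insert w0 B \<subseteq> ball 0 R"
      using bounded_subset_ballD by blast
    then have R: "insert w0 B \<subseteq> cball 0 R" using ball_subset_cball by (rule order_trans)
    have "isCont (\<lambda>w. h (X *v w)) w" for w
      using differentiable_imp_continuous_within[OF diff]
        linear_continuous_at[OF matrix_vector_mul_bounded_linear]
      by (rule isCont_o2[rotated])
    then have "continuous_on UNIV F"
      unfolding F using cont_r
      by (intro continuous_on_add) (auto intro: continuous_at_imp_continuous_on)
    then have "compact (F ` cball 0 R)"
      by (intro compact_continuous_image) (auto intro: continuous_on_subset)
    then have "bounded (F ` cball 0 R)" by (rule compact_imp_bounded)
    then obtain M where M: "\<And>w. w \<in> cball 0 R \<Longrightarrow> \<bar>F w\<bar> \<le> M"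
      unfolding bounded_iff real_norm_def by blast
    \<comment> \<open>Since \<open>domh\<close> need not be convex, \<open>U\<close> is kept inside the range of \<open>X\<close>,
      which is a subspace contained in \<open>domh\<close>.\<close>
    define U where "U = (*v) X ` cball 0 R"
    have U: "U \<subseteq> domh" "convex U" "compact U"
      unfolding U_def by (intro img; simp)+
    obtain \<mu> where \<mu>: "strongly_convex_on U \<mu> h" using A2_strong[OF U] by blast
    have "(w0, ?ss) \<in> ?Z" by (simp add: Z mem_epigraph)
    then have "?Z \<noteq> {}" by blast
    with hoffman_constant_exists[of ?Z C b X ?rs ?ss]
    obtain \<theta> where \<theta>: "hoffman_constant ?Z C b X ?rs ?ss \<theta>"
      using Z B1_poly by auto
    have "F w - Fstar \<le> \<bar>M\<bar> + \<bar>Fstar\<bar> + 1" if "w \<in> B" for w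
      using M[of w] that R by auto
    moreover have "?rs \<in> U" "\<And>w. w \<in> B \<Longrightarrow> X *v w \<in> U"
      using R by (auto simp: U_def)
    ultimately show ?thesis
      using U \<mu> \<theta> by (intro exI[of _ "\<bar>M\<bar> + \<bar>Fstar\<bar> + 1"] exI[of _ U] exI[of _ \<mu>] exI[of _ \<theta>]) auto
  qed

  have bound: "\<beta> > 0 \<and> (\<forall>w\<in>B. F w - Fstar \<ge> \<beta> / 2 * (norm (w - closest_point W w))\<^sup>2)"
    if M: "M > 0" "\<forall>w\<in>B. F w - Fstar \<le> M" and U: "?rs \<in> U" "\<forall>w\<in>B. X *v w \<in> U"
      and sc: "strongly_convex_on U \<mu> h" and ho: "hoffman_constant ?Z C b X ?rs ?ss \<theta>"
      and \<beta>: "\<beta> = 1 / (\<theta>\<^sup>2 * ((1 + 2 * (norm (gradient h ?rs))\<^sup>2) / \<mu> + M))"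
    for M U \<mu> \<theta> \<beta>
  proof -
    let ?G = "norm (gradient h ?rs)"
    have \<mu>: "\<mu> > 0" using sc by (simp add: strongly_convex_on_def)
    have \<theta>: "\<theta> > 0" using ho by (simp add: hoffman_constant_def)
    define \<kappa> where "\<kappa> = (1 + 2 * ?G\<^sup>2) / \<mu> + M"
    have \<kappa>: "\<kappa> > 0" unfolding \<kappa>_def using \<mu> M(1) by (intro add_nonneg_pos) auto
    have \<beta>: "\<beta> = 1 / (\<theta>\<^sup>2 * \<kappa>)" using \<beta> by (simp add: \<kappa>_def)
    have "\<beta> / 2 * (norm (w - closest_point W w))\<^sup>2 \<le> F w - Fstar" if w: "w \<in> B" for w
    proof -
      define p where "p = gradient h ?rs \<bullet> (X *v w - ?rs) + (r w - ?ss)"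
      have p: "0 \<le> p" "p + \<mu> / 2 * (norm (X *v w - ?rs))\<^sup>2 \<le> F w - Fstar"
        using composite_strong_gap[OF diff B1_convex min_h sc U(1), of w] U(2) w
        by (auto simp: p_def F Fstar)
      have "\<bar>(r w - ?ss) - p\<bar> \<le> ?G * norm (X *v w - ?rs)"
        using Cauchy_Schwarz_ineq2[of "gradient h ?rs" "X *v w - ?rs"] by (simp add: p_def)
      then have res: "(norm (X *v w - ?rs))\<^sup>2 + (r w - ?ss)\<^sup>2 \<le> 2 * \<kappa> * (F w - Fstar)"
        unfolding \<kappa>_def using \<mu> p M(2) w by (intro residual_bound_arith[of \<mu> p]) auto
      \<comment> \<open>The lifted point lies on the graph of \<open>r\<close>, so it satisfies all the inequalities and
        only the two equation residuals remain in the error bound.\<close>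
      obtain w' t' where z': "(w', t') \<in> ?Z" "(norm ((w, r w) - (w', t')))\<^sup>2 \<le>
        \<theta>\<^sup>2 * ((norm (pos_part (rows_mult C (w, r w) - b)))\<^sup>2
             + (norm (X *v w - ?rs))\<^sup>2 + (r w - ?ss)\<^sup>2)"
        using ho unfolding hoffman_constant_def by (metis surj_pair)
      have "(w, r w) \<in> polyhedral_set C b"
        unfolding B1_poly[symmetric] by (simp add: mem_epigraph)
      then have "pos_part (rows_mult C (w, r w) - b) = 0"
        by (simp add: vec_eq_iff pos_part_nth polyhedral_set_def)
      with z'(2) have z'2: "(norm ((w, r w) - (w', t')))\<^sup>2 \<le>
        \<theta>\<^sup>2 * ((norm (X *v w - ?rs))\<^sup>2 + (r w - ?ss)\<^sup>2)" by simp
      have "X *v w' = ?rs" "r w' \<le> ?ss" using z'(1) by (auto simp: Z mem_epigraph)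
      then have "w' \<in> W" using W_eq min_h[of w'] by auto
      then have "norm (w - closest_point W w) \<le> norm (w - w')"
        using closest_point_le[OF W_closed, of w' w] by (simp add: dist_norm)
      also have "\<dots> \<le> norm ((w, r w) - (w', t'))"
        by (simp add: norm_Pair real_le_rsqrt)
      finally have "(norm (w - closest_point W w))\<^sup>2 \<le> (norm ((w, r w) - (w', t')))\<^sup>2"
        by (simp add: power_mono)
      also note z'2
      also have "\<theta>\<^sup>2 * ((norm (X *v w - ?rs))\<^sup>2 + (r w - ?ss)\<^sup>2) \<le> \<theta>\<^sup>2 * (2 * \<kappa> * (F w - Fstar))"
        by (intro mult_left_mono res) simp
      finally show ?thesis using \<theta> \<kappa> by (simp add: \<beta> field_simps)
    qed
    moreover have "\<beta> > 0" using \<theta> \<kappa> by (simp add: \<beta>)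
    ultimately show ?thesis by blast
  qed

  have rs_ss_unique: "rs = ?rs \<and> ss = ?ss" if "W = {w. X *v w = rs \<and> r w = ss}" for rs ss
    using w0 that by auto
  show ?thesis
  proof (intro conjI allI impI)
    show "\<exists>rs ss. W = {w. X *v w = rs \<and> r w = ss}" using W_eq by blast
  next
    fix rs ss assume "W = {w. X *v w = rs \<and> r w = ss}"
    then have eq: "rs = ?rs" "ss = ?ss" using rs_ss_unique by auto
    show "?Z = {(w, t) \<in> epigraph UNIV r. X *v w = rs \<and> t = ss}"
      unfolding eq by (rule Z)
    show "\<exists>M U \<mu> \<theta>. M > 0 \<and> (\<forall>w\<in>B. F w - Fstar \<le> M) \<and>
        U \<subseteq> domh \<and> convex U \<and> compact U \<and> rs \<in> U \<and> (\<forall>w\<in>B. X *v w \<in> U) \<and>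
        strongly_convex_on U \<mu> h \<and> hoffman_constant ?Z C b X rs ss \<theta>"
      unfolding eq by (rule constants_exist)
  next
    fix rs ss M U \<mu> \<theta>
    assume "W = {w. X *v w = rs \<and> r w = ss}"
    then have eq: "rs = ?rs" "ss = ?ss" using rs_ss_unique by auto
    assume "M > 0 \<and> (\<forall>w\<in>B. F w - Fstar \<le> M) \<and>
        U \<subseteq> domh \<and> convex U \<and> compact U \<and> rs \<in> U \<and> (\<forall>w\<in>B. X *v w \<in> U) \<and>
        strongly_convex_on U \<mu> h \<and> hoffman_constant ?Z C b X rs ss \<theta>"
    then show "let \<beta> = 1 / (\<theta>\<^sup>2 * ((1 + 2 * (norm (gradient h rs))\<^sup>2) / \<mu> + M)) in
          \<beta> > 0 \<and> (\<forall>w\<in>B. F w - Fstar \<ge> \<beta> / 2 * (norm (w - closest_point W w))\<^sup>2)"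
      unfolding eq Let_def by (intro bound[of M U \<mu> \<theta>]) auto
  qed
qed

end
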